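(* Let $n,N\ge1$ and let $q\in\mathbb{C}^\times$ be not a root of unity. The two right actions of the affine Hecke algebra $\widehat{H}_N(q^2)$ on $V_n(z)^{\otimes N}$ given by formulas (A) and (B) of the context agree: in both, $y_i$ acts by multiplication by $z_i^{-1}$, and for every $1\le i\le N-1$ and every basis vector $v_{\mathbf{j}}\otimes\mathbf{z}$ the right-hand sides of (A) and (B) for $(v_{\mathbf{j}}\otimes\mathbf{z})\cdot T_i$ are equal.
   Context: $V_n$ is the complex vector space with basis $v_1,\dots,v_n$. $V_n(z)^{\otimes N}=V_n^{\otimes N}\otimes\mathbb{C}[z_1^{\pm1},\dots,z_N^{\pm1}]$ has the basis $v_{\mathbf{j}}\otimes\mathbf{z}$ with $v_{\mathbf{j}}=v_{j_1}\otimes\cdots\otimes v_{j_N}$, $\mathbf{j}=(j_1,\dots,j_N)\in\{1,\dots,n\}^N$, and $\mathbf{z}=z_1^{k_1}\cdots z_N^{k_N}$ a Laurent monomial. $s_i(\mathbf{j})$ is $\mathbf{j}$ with $j_i,j_{i+1}$ interchanged, and $\mathbf{z}^{s_i}$ is $\mathbf{z}$ with the variables $z_i,z_{i+1}$ interchanged. The affine Hecke algebra is generated by $T_1,\dots,T_{N-1},y_1^{\pm1},\dots,y_N^{\pm1}$. Formula (A) (Ginzburg–Reshetikhin–Vasserot): $$(v_{\mathbf{j}}\otimes\mathbf{z})\cdot T_i=\begin{cases}(1-q^2)\,v_{\mathbf{j}}\otimes\frac{z_{i+1}\mathbf{z}^{s_i}-z_i\mathbf{z}}{z_i-z_{i+1}}-q\,v_{s_i(\mathbf{j})}\otimes\mathbf{z}^{s_i}&j_i<j_{i+1},\\(1-q^2)\,v_{\mathbf{j}}\otimes\frac{z_i(\mathbf{z}^{s_i}-\mathbf{z})}{z_i-z_{i+1}}-v_{s_i(\mathbf{j})}\otimes\mathbf{z}^{s_i}&j_i=j_{i+1},\\(1-q^2)\,v_{\mathbf{j}}\otimes\frac{z_i(\mathbf{z}^{s_i}-\mathbf{z})}{z_i-z_{i+1}}-q\,v_{s_i(\mathbf{j})}\otimes\mathbf{z}^{s_i}&j_i>j_{i+1}.\end{cases}$$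 Formula (B) (via the affine $R$-matrix): $$(v_{\mathbf{j}}\otimes\mathbf{z})\cdot T_i=(q^2-1)\frac{z_i}{z_i-z_{i+1}}\,v_{\mathbf{j}}\otimes\mathbf{z}-\frac{q}{z_i-z_{i+1}}\,(\tau R)_{i,i+1}(z_i,z_{i+1})\,v_{\mathbf{j}}\otimes\mathbf{z}^{s_i},$$ where $(\tau R)_{i,i+1}$ means that the operator $\tau R(z_i,z_{i+1})\in\mathrm{End}(V_n\otimes V_n)\otimes\mathbb{C}[z_i,z_{i+1}]$ acts on the tensor factors $i,i+1$ (its polynomial coefficients multiplying $\mathbf{z}^{s_i}$), and, with $e_{ab}\in\mathrm{End}(V_n)$ the matrix units $e_{ab}v_c=\delta_{bc}v_a$ and writing $x=z_i$, $y=z_{i+1}$, $$\tau R(x,y)=\sum_{a}(qx-q^{-1}y)\,e_{aa}\otimes e_{aa}+\sum_{a\ne b}(x-y)\,e_{ba}\otimes e_{ab}+\sum_{a>b}(q-q^{-1})\big(x\,e_{aa}\otimes e_{bb}+y\,e_{bb}\otimes e_{aa}\big).$$ *)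

theory Defs
  imports
    Complex_Main
    "HOL-Library.FuncSet"
    "HOL-Library.Poly_Mapping"
    "HOL-Combinatorics.Transposition"
    "HOL-Computational_Algebra.Fraction_Field"
    "HOL-Algebra.QuotRing"
begin

section \<open>Laurent polynomials and the space on which the algebra acts\<close>

text \<open>
  A Laurent polynomial is an element of the group algebra over the complex numbers of the group of
  finitely supported exponent vectors. The type has a variable \<open>z\<^sub>i\<close> for every natural number \<open>i\<close>;
  the restriction to \<open>z\<^sub>1, \<dots>, z\<^sub>N\<close> is made in the carrier \<open>Vz\<close> below.
\<close>

type_synonym laurent = "(nat \<Rightarrow>\<^sub>0 int) \<Rightarrow>\<^sub>0 complex"

definition monomial :: "(nat \<Rightarrow>\<^sub>0 int) \<Rightarrow> laurent"
  where "monomial k = Poly_Mapping.single k 1"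

definition const :: "complex \<Rightarrow> laurent"
  where "const c = Poly_Mapping.single 0 c"

text \<open>
  A tensor product of copies of \<open>V\<^sub>n\<close> with a commutative ring \<open>R\<close> is the free \<open>R\<close>-module on the
  \<open>v\<^sub>j\<close>; its elements are finitely supported functions from multi-indices \<open>j\<close> to \<open>R\<close>, and
  \<open>v\<^sub>j \<otimes> f\<close> is \<open>Poly_Mapping.single j f\<close>. Multi-indices are indexed from 1.
\<close>

definition multi_indices :: "nat \<Rightarrow> nat \<Rightarrow> (nat \<Rightarrow> nat) set"
  where "multi_indices n N = {1..N} \<rightarrow>\<^sub>E {1..n}"

definition exponents :: "nat \<Rightarrow> (nat \<Rightarrow>\<^sub>0 int) set"
  where "exponents N = {k. Poly_Mapping.keys k \<subseteq> {1..N}}"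

definition smult :: "'r::comm_ring_1 \<Rightarrow> ('j \<Rightarrow>\<^sub>0 'r) \<Rightarrow> ('j \<Rightarrow>\<^sub>0 'r)"
  where "smult c F = Poly_Mapping.map (\<lambda>f. c * f) F"

definition Vz :: "nat \<Rightarrow> nat \<Rightarrow> ((nat \<Rightarrow> nat) \<Rightarrow>\<^sub>0 laurent) set"
  where "Vz n N = {F. Poly_Mapping.keys F \<subseteq> multi_indices n N \<and>
           (\<forall>j. Poly_Mapping.keys (Poly_Mapping.lookup F j) \<subseteq> exponents N)}"

definition basis_vec :: "(nat \<Rightarrow> nat) \<Rightarrow> (nat \<Rightarrow>\<^sub>0 int) \<Rightarrow> ((nat \<Rightarrow> nat) \<Rightarrow>\<^sub>0 laurent)"
  where "basis_vec j k = Poly_Mapping.single j (monomial k)"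

definition swap_index :: "nat \<Rightarrow> (nat \<Rightarrow> nat) \<Rightarrow> (nat \<Rightarrow> nat)"
  where "swap_index i j = j \<circ> Transposition.transpose i (i + 1)"

definition swap_exponent :: "nat \<Rightarrow> (nat \<Rightarrow>\<^sub>0 int) \<Rightarrow> (nat \<Rightarrow>\<^sub>0 int)"
  where "swap_exponent i k = Poly_Mapping.map_key (Transposition.transpose i (i + 1)) k"


section \<open>The two formulas\<close>

text \<open>
  The individual terms of the formulas have denominators \<open>z\<^sub>i - z\<^sub>i\<^sub>+\<^sub>1\<close>, so the right-hand sides are
  read in the extension of scalars to the field of rational functions.
\<close>

type_synonym ratfun = "laurent fract"

definition rat :: "laurent \<Rightarrow> ratfun"
  where "rat f = Fraction_Field.Fract f 1"

definition to_rat :: "((nat \<Rightarrow> nat) \<Rightarrow>\<^sub>0 laurent) \<Rightarrow> ((nat \<Rightarrow> nat) \<Rightarrow>\<^sub>0 ratfun)"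
  where "to_rat F = Poly_Mapping.map rat F"

abbreviation cst :: "complex \<Rightarrow> ratfun"
  where "cst c \<equiv> rat (const c)"

abbreviation mon :: "(nat \<Rightarrow>\<^sub>0 int) \<Rightarrow> ratfun"
  where "mon k \<equiv> rat (monomial k)"

abbreviation var :: "nat \<Rightarrow> ratfun"
  where "var i \<equiv> mon (Poly_Mapping.single i 1)"

abbreviation pure_tensor :: "(nat \<Rightarrow> nat) \<Rightarrow> ratfun \<Rightarrow> ((nat \<Rightarrow> nat) \<Rightarrow>\<^sub>0 ratfun)"
  where "pure_tensor j f \<equiv> Poly_Mapping.single j f"

definition formula_A ::
  "complex \<Rightarrow> nat \<Rightarrow> (nat \<Rightarrow> nat) \<Rightarrow> (nat \<Rightarrow>\<^sub>0 int) \<Rightarrow> ((nat \<Rightarrow> nat) \<Rightarrow>\<^sub>0 ratfun)"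
  where "formula_A q i j k =
    (let x = var i; y = var (i + 1); z = mon k; zs = mon (swap_exponent i k); sj = swap_index i j in
     if j i < j (i + 1) then
       smult (cst (1 - q\<^sup>2)) (pure_tensor j ((y * zs - x * z) / (x - y)))
         - smult (cst q) (pure_tensor sj zs)
     else if j i = j (i + 1) then
       smult (cst (1 - q\<^sup>2)) (pure_tensor j ((x * (zs - z)) / (x - y)))
         - pure_tensor sj zs
     else
       smult (cst (1 - q\<^sup>2)) (pure_tensor j ((x * (zs - z)) / (x - y)))
         - smult (cst q) (pure_tensor sj zs))"

text \<open>\<open>matrix_unit p a b\<close> is \<open>e\<^sub>a\<^sub>b\<close> on the \<open>p\<close>-th tensor factor, extended linearly.\<close>

definition matrix_unit ::
  "nat \<Rightarrow> nat \<Rightarrow> nat \<Rightarrow> ((nat \<Rightarrow> nat) \<Rightarrow>\<^sub>0 ratfun) \<Rightarrow> ((nat \<Rightarrow> nat) \<Rightarrow>\<^sub>0 ratfun)"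
  where "matrix_unit p a b F =
    (\<Sum>j\<in>Poly_Mapping.keys F.
       if j p = b then pure_tensor (j(p := a)) (Poly_Mapping.lookup F j) else 0)"

text \<open>\<open>matrix_unit2 i a b c d\<close> is \<open>e\<^sub>a\<^sub>b \<otimes> e\<^sub>c\<^sub>d\<close> on the tensor factors \<open>i\<close> and \<open>i + 1\<close>.\<close>

definition matrix_unit2 ::
  "nat \<Rightarrow> nat \<Rightarrow> nat \<Rightarrow> nat \<Rightarrow> nat \<Rightarrow>
    ((nat \<Rightarrow> nat) \<Rightarrow>\<^sub>0 ratfun) \<Rightarrow> ((nat \<Rightarrow> nat) \<Rightarrow>\<^sub>0 ratfun)"
  where "matrix_unit2 i a b c d F = matrix_unit i a b (matrix_unit (i + 1) c d F)"

definition tau_R ::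
  "nat \<Rightarrow> complex \<Rightarrow> nat \<Rightarrow> ratfun \<Rightarrow> ratfun \<Rightarrow>
    ((nat \<Rightarrow> nat) \<Rightarrow>\<^sub>0 ratfun) \<Rightarrow> ((nat \<Rightarrow> nat) \<Rightarrow>\<^sub>0 ratfun)"
  where "tau_R n q i x y F =
      (\<Sum>a\<in>{1..n}. smult (cst q * x - cst (inverse q) * y) (matrix_unit2 i a a a a F))
    + (\<Sum>(a, b)\<in>{(a, b). a \<in> {1..n} \<and> b \<in> {1..n} \<and> a \<noteq> b}.
         smult (x - y) (matrix_unit2 i b a a b F))
    + (\<Sum>(a, b)\<in>{(a, b). a \<in> {1..n} \<and> b \<in> {1..n} \<and> a > b}.
         smult (cst (q - inverse q))
           (smult x (matrix_unit2 i a a b b F) + smult y (matrix_unit2 i b b a a F)))"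

definition formula_B ::
  "nat \<Rightarrow> complex \<Rightarrow> nat \<Rightarrow> (nat \<Rightarrow> nat) \<Rightarrow> (nat \<Rightarrow>\<^sub>0 int) \<Rightarrow> ((nat \<Rightarrow> nat) \<Rightarrow>\<^sub>0 ratfun)"
  where "formula_B n q i j k =
    (let x = var i; y = var (i + 1); z = mon k; zs = mon (swap_exponent i k) in
     smult (cst (q\<^sup>2 - 1) * (x / (x - y))) (pure_tensor j z)
       - smult (cst q / (x - y)) (tau_R n q i x y (pure_tensor j zs)))"


section \<open>The affine Hecke algebra\<close>

datatype hecke_gen = T nat | Y nat | Yinv nat

datatype word = Word (letters: "hecke_gen list")

instantiation word :: monoid_add
begin

definition zero_word :: word
  where "0 = Word []"

definition plus_word :: "word \<Rightarrow> word \<Rightarrow> word"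
  where "u + w = Word (letters u @ letters w)"

instance
  by standard (simp_all add: zero_word_def plus_word_def)

end

text \<open>
  Words form a free monoid, written additively, so the type \<open>word \<Rightarrow>\<^sub>0 complex\<close> with convolution as
  multiplication is a free associative algebra.
\<close>

type_synonym free_poly = "word \<Rightarrow>\<^sub>0 complex"

definition hecke_gens :: "nat \<Rightarrow> hecke_gen set"
  where "hecke_gens N = T ` {1..<N} \<union> Y ` {1..N} \<union> Yinv ` {1..N}"

definition free_alg :: "nat \<Rightarrow> free_poly ring"
  where "free_alg N =
    \<lparr>carrier = {p. \<forall>w\<in>Poly_Mapping.keys p. set (letters w) \<subseteq> hecke_gens N},
     mult = (*), one = 1, zero = 0, add = (+)\<rparr>"

definition gen :: "hecke_gen \<Rightarrow> free_poly"
  where "gen g = Poly_Mapping.single (Word [g]) 1"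

definition scalar :: "complex \<Rightarrow> free_poly"
  where "scalar c = Poly_Mapping.single 0 c"

definition hecke_relations :: "nat \<Rightarrow> complex \<Rightarrow> free_poly set"
  where "hecke_relations N t =
      {(gen (T i) + 1) * (gen (T i) - scalar t) |i. i \<in> {1..<N}}
    \<union> {gen (T i) * gen (T (i + 1)) * gen (T i) - gen (T (i + 1)) * gen (T i) * gen (T (i + 1))
         |i. i \<in> {1..<N} \<and> i + 1 \<in> {1..<N}}
    \<union> {gen (T i) * gen (T j) - gen (T j) * gen (T i)
         |i j. i \<in> {1..<N} \<and> j \<in> {1..<N} \<and> i + 1 < j}
    \<union> {gen (Y i) * gen (Yinv i) - 1 |i. i \<in> {1..N}}
    \<union> {gen (Yinv i) * gen (Y i) - 1 |i. i \<in> {1..N}}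
    \<union> {gen (Y i) * gen (Y j) - gen (Y j) * gen (Y i) |i j. i \<in> {1..N} \<and> j \<in> {1..N}}
    \<union> {gen (Y j) * gen (T i) - gen (T i) * gen (Y j)
         |i j. i \<in> {1..<N} \<and> j \<in> {1..N} \<and> j \<noteq> i \<and> j \<noteq> i + 1}
    \<union> {gen (T i) * gen (Y i) * gen (T i) - scalar t * gen (Y (i + 1)) |i. i \<in> {1..<N}}"

text \<open>\<open>affine_hecke N t\<close> has the quadratic relation \<open>(T\<^sub>i + 1)(T\<^sub>i - t) = 0\<close>.\<close>

definition hecke_ideal :: "nat \<Rightarrow> complex \<Rightarrow> free_poly set"
  where "hecke_ideal N t = genideal (free_alg N) (hecke_relations N t)"

definition affine_hecke :: "nat \<Rightarrow> complex \<Rightarrow> free_poly set ring"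
  where "affine_hecke N t = free_alg N Quot hecke_ideal N t"

definition hecke_class :: "nat \<Rightarrow> complex \<Rightarrow> free_poly \<Rightarrow> free_poly set"
  where "hecke_class N t p = hecke_ideal N t +>\<^bsub>free_alg N\<^esub> p"


section \<open>Right actions\<close>

text \<open>
  Right modules over a complex algebra: \<open>H\<close> is the underlying ring and \<open>\<iota>\<close> its structure map from
  the complex numbers. Linearity of \<open>\<lambda>v. act v h\<close> over the complex numbers follows from the last
  two conditions when the image of \<open>\<iota>\<close> is central.
\<close>

definition right_action ::
  "'h ring \<Rightarrow> (complex \<Rightarrow> 'h) \<Rightarrow> 'v::ab_group_add set \<Rightarrow> (complex \<Rightarrow> 'v \<Rightarrow> 'v) \<Rightarrow>
    ('v \<Rightarrow> 'h \<Rightarrow> 'v) \<Rightarrow> bool"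
  where "right_action H \<iota> V scale act \<longleftrightarrow>
      (\<forall>v\<in>V. \<forall>h\<in>carrier H. act v h \<in> V)
    \<and> (\<forall>v\<in>V. \<forall>w\<in>V. \<forall>h\<in>carrier H. act (v + w) h = act v h + act w h)
    \<and> (\<forall>v\<in>V. \<forall>g\<in>carrier H. \<forall>h\<in>carrier H. act v (g \<oplus>\<^bsub>H\<^esub> h) = act v g + act v h)
    \<and> (\<forall>v\<in>V. act v \<one>\<^bsub>H\<^esub> = v)
    \<and> (\<forall>v\<in>V. \<forall>g\<in>carrier H. \<forall>h\<in>carrier H. act v (g \<otimes>\<^bsub>H\<^esub> h) = act (act v g) h)
    \<and> (\<forall>v\<in>V. \<forall>c. act v (\<iota> c) = scale c v)"

definition hecke_action ::
  "nat \<Rightarrow> nat \<Rightarrow> complex \<Rightarrow>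
    (((nat \<Rightarrow> nat) \<Rightarrow>\<^sub>0 laurent) \<Rightarrow> free_poly set \<Rightarrow> ((nat \<Rightarrow> nat) \<Rightarrow>\<^sub>0 laurent)) \<Rightarrow> bool"
  where "hecke_action n N t act \<longleftrightarrow>
    right_action (affine_hecke N t) (\<lambda>c. hecke_class N t (scalar c))
      (Vz n N) (\<lambda>c. smult (const c)) act"

definition acts_by ::
  "nat \<Rightarrow> nat \<Rightarrow> complex \<Rightarrow>
    (nat \<Rightarrow> (nat \<Rightarrow> nat) \<Rightarrow> (nat \<Rightarrow>\<^sub>0 int) \<Rightarrow> ((nat \<Rightarrow> nat) \<Rightarrow>\<^sub>0 ratfun)) \<Rightarrow>
    (((nat \<Rightarrow> nat) \<Rightarrow>\<^sub>0 laurent) \<Rightarrow> free_poly set \<Rightarrow> ((nat \<Rightarrow> nat) \<Rightarrow>\<^sub>0 laurent)) \<Rightarrow> bool"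
  where "acts_by n N t rhs act \<longleftrightarrow>
      (\<forall>i\<in>{1..N}. \<forall>v\<in>Vz n N.
         act v (hecke_class N t (gen (Y i))) = smult (monomial (Poly_Mapping.single i (-1))) v)
    \<and> (\<forall>i\<in>{1..<N}. \<forall>j\<in>multi_indices n N. \<forall>k\<in>exponents N.
         to_rat (act (basis_vec j k) (hecke_class N t (gen (T i)))) = rhs i j k)"

end

theory Submission
  imports Defs
begin

text \<open>
  Evaluated on a basis tensor, each of the three sums in the R-matrix has at most one nonzero term, so
  both formulas become explicit combinations of \<open>v\<^sub>j\<close> and \<open>v\<close> at the swapped index, and comparing
  coefficients is arithmetic in the field of rational functions. Since a right action is additive
  and compatible with scalars, it is determined by the \<open>T\<^sub>i\<close> on basis vectors and by the \<open>y\<^sub>i\<close>; the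
  action of \<open>y\<^sub>i\<^sup>-\<^sup>1\<close> is forced because \<open>y\<^sub>i\<close> acts by an invertible Laurent monomial.
\<close>

section \<open>Scalar multiplication\<close>

lemma smult_lookup [simp]: "Poly_Mapping.lookup (smult c F) j = c * Poly_Mapping.lookup F j"
  by (simp add: smult_def Poly_Mapping.map.rep_eq when_def)

lemma smult_zero [simp]: "smult c 0 = 0"
  by (rule poly_mapping_eqI) simp

lemma smult_add: "smult c (F + G) = smult c F + smult c G"
  by (rule poly_mapping_eqI) (simp add: lookup_add algebra_simps)

lemma smult_smult: "smult c (smult d F) = smult (c * d) F"
  by (rule poly_mapping_eqI) (simp add: algebra_simps)

lemma smult_one [simp]: "smult 1 F = F"
  by (rule poly_mapping_eqI) simp

lemma smult_single [simp]: "smult c (Poly_Mapping.single j f) = Poly_Mapping.single j (c * f)"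
  by (rule poly_mapping_eqI) (simp add: lookup_single when_def)

section \<open>Comparison of the two formulas\<close>

lemma matrix_unit_single:
  "matrix_unit p a b (pure_tensor j f) = (if j p = b then pure_tensor (j(p := a)) f else 0)"
  by (cases "f = 0") (auto simp: matrix_unit_def)

lemma matrix_unit_zero [simp]: "matrix_unit p a b 0 = 0"
  by (simp add: matrix_unit_def)

text \<open>The operators on positions \<open>i\<close> and \<open>i + 1\<close> touch different
  entries of \<open>j\<close>, so the test at \<open>i\<close> still sees the original letter after
  \<open>i + 1\<close> has been updated, and the two updates commute.\<close>

lemma matrix_unit2_single:
  "matrix_unit2 i a b c d (pure_tensor j f) =
     (if j i = b \<and> j (i + 1) = d then pure_tensor (j(i := a, i + 1 := c)) f else 0)"
  by (auto simp: matrix_unit2_def matrix_unit_single fun_upd_twist)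

lemma swap_index_eq: "swap_index i j = j(i := j (i + 1), i + 1 := j i)"
  by (auto simp: swap_index_def Transposition.transpose_def)

text \<open>Diagonal units write back the letters just tested, so they leave the multi-index
  alone.\<close>

lemma matrix_unit2_diag_single:
  "matrix_unit2 i a a b b (pure_tensor j f) =
     (if j i = a \<and> j (i + 1) = b then pure_tensor j f else 0)"
  by (auto simp: matrix_unit2_single intro!: arg_cong2[where f = Poly_Mapping.single])

text \<open>The second and third sums test for two different letters and vanish on equal neighbours;
  the first keeps only \<open>a = j i\<close>, which the range hypothesis puts into the sum.\<close>

lemma tau_R_single_eq:
  assumes "j i \<in> {1..n}" and "j i = j (i + 1)"
  shows "tau_R n q i x y (pure_tensor j f) =
           pure_tensor j ((cst q * x - cst (inverse q) * y) * f)"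
proof -
  have "(\<Sum>a\<in>{1..n}. smult (cst q * x - cst (inverse q) * y) (matrix_unit2 i a a a a (pure_tensor j f)))
      = (\<Sum>a\<in>{1..n}. if a = j i then pure_tensor j ((cst q * x - cst (inverse q) * y) * f) else 0)"
    by (rule sum.cong) (auto simp: matrix_unit2_diag_single assms(2))
  moreover have "(\<Sum>(a, b)\<in>{(a, b). a \<in> {1..n} \<and> b \<in> {1..n} \<and> a \<noteq> b}.
      smult (x - y) (matrix_unit2 i b a a b (pure_tensor j f))) = 0"
    by (rule sum.neutral) (auto simp: matrix_unit2_single assms(2))
  moreover have "(\<Sum>(a, b)\<in>{(a, b). a \<in> {1..n} \<and> b \<in> {1..n} \<and> a > b}.
      smult (cst (q - inverse q)) (smult x (matrix_unit2 i a a b b (pure_tensor j f))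
        + smult y (matrix_unit2 i b b a a (pure_tensor j f)))) = 0"
    by (rule sum.neutral) (auto simp: matrix_unit2_single assms(2))
  ultimately show ?thesis
    using assms(1) by (simp add: tau_R_def)
qed

text \<open>The first sum tests for equal letters and vanishes. The second keeps
  \<open>(a, b) = (j i, j (i + 1))\<close>, which swaps the letters. In the third, \<open>a\<close>
  must be the larger letter; the factor is \<open>x\<close> if it stands at \<open>i\<close>, and
  \<open>y\<close> if it stands at \<open>i + 1\<close>.\<close>

lemma tau_R_single_neq:
  assumes "j i \<in> {1..n}" and "j (i + 1) \<in> {1..n}" and "j i \<noteq> j (i + 1)"
  shows "tau_R n q i x y (pure_tensor j f) =
           pure_tensor (swap_index i j) ((x - y) * f) +
           pure_tensor j (cst (q - inverse q) * ((if j i > j (i + 1) then x else y) * f))"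
proof -
  let ?O = "{(a, b). a \<in> {1..n} \<and> b \<in> {1..n} \<and> a \<noteq> b}"
  let ?D = "{(a, b). a \<in> {1..n} \<and> b \<in> {1..n} \<and> a > b}"
  \<comment> \<open>\<open>(?hi, ?lo)\<close> is the only pair with \<open>a > b\<close> made of the
    two letters of \<open>j\<close>. Writing each sum with an indicator of one pair lets it collapse
    to that term.\<close>
  let ?hi = "max (j i) (j (i + 1))" and ?lo = "min (j i) (j (i + 1))"
  have fin: "finite ?O" "finite ?D"
    by (rule finite_subset[of _ "{1..n} \<times> {1..n}"]; auto)+
  have "(\<Sum>a\<in>{1..n}. smult (cst q * x - cst (inverse q) * y)
      (matrix_unit2 i a a a a (pure_tensor j f))) = 0"
    using assms(3) by (intro sum.neutral) (auto simp: matrix_unit2_single)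
  moreover have "(\<Sum>(a, b)\<in>?O. smult (x - y) (matrix_unit2 i b a a b (pure_tensor j f)))
      = (\<Sum>p\<in>?O. if p = (j i, j (i + 1)) then pure_tensor (swap_index i j) ((x - y) * f) else 0)"
    by (rule sum.cong) (auto simp: matrix_unit2_single swap_index_eq split: if_splits)
  moreover have "(\<Sum>(a, b)\<in>?D.
      smult (cst (q - inverse q)) (smult x (matrix_unit2 i a a b b (pure_tensor j f))
        + smult y (matrix_unit2 i b b a a (pure_tensor j f))))
      = (\<Sum>p\<in>?D. if p = (?hi, ?lo) then
          pure_tensor j (cst (q - inverse q) * ((if j i > j (i + 1) then x else y) * f)) else 0)"
  proof (rule sum.cong)
    fix p assume "p \<in> ?D"
    then obtain a b where p: "p = (a, b)" "b < a" by auto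
    consider "j i = a" "j (i + 1) = b" | "j i = b" "j (i + 1) = a"
      | "\<not> (j i = a \<and> j (i + 1) = b)" "\<not> (j i = b \<and> j (i + 1) = a)" by blast
    then show "(case p of (a, b) \<Rightarrow>
        smult (cst (q - inverse q)) (smult x (matrix_unit2 i a a b b (pure_tensor j f))
          + smult y (matrix_unit2 i b b a a (pure_tensor j f))))
        = (if p = (?hi, ?lo) then
            pure_tensor j (cst (q - inverse q) * ((if j i > j (i + 1) then x else y) * f)) else 0)"
      unfolding p(1) prod.case matrix_unit2_diag_single
    proof cases
      case 3
      then have "(a, b) \<noteq> (?hi, ?lo)"
        by (auto simp: max_def min_def)
      with 3 show "smult (cst (q - inverse q))
          (smult x (if j i = a \<and> j (i + 1) = b then pure_tensor j f else 0)
            + smult y (if j i = b \<and> j (i + 1) = a then pure_tensor j f else 0))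
          = (if (a, b) = (?hi, ?lo) then
              pure_tensor j (cst (q - inverse q) * ((if j i > j (i + 1) then x else y) * f)) else 0)"
        by (simp only: if_False smult_zero add_0)
    qed (use p(2) in simp_all)
  qed simp
  ultimately show ?thesis
    using assms fin by (simp add: tau_R_def max_def min_def)
qed

section \<open>Embedding of Laurent polynomials into rational functions\<close>

lemma rat_simps:
  "rat 0 = 0" "rat 1 = 1" "rat (f - g) = rat f - rat g"
  "rat (f * g) = rat f * rat g"
  by (simp_all add: rat_def Zero_fract_def One_fract_def)

lemma rat_eq_iff [simp]: "rat f = rat g \<longleftrightarrow> f = g"
  by (simp add: rat_def eq_fract)

lemma const_simps:
  "const 1 = 1" "const (c - d) = const c - const d"
  "const (c * d) = const c * const d"
  by (simp_all add: const_def single_diff mult_single)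

text \<open>This makes the denominators of both formulas nonzero.\<close>

lemma var_neq: "i \<noteq> i' \<Longrightarrow> var i \<noteq> var i'"
  by (metis lookup_single_eq lookup_single_not_eq monomial_def rat_eq_iff zero_neq_one)

text \<open>The swapped tensor has coefficient \<open>- q * zs\<close> on both sides when the
  letters differ, because \<open>x - y\<close> cancels. What remains is one identity of coefficients
  of \<open>v_j\<close> in each of the three cases.\<close>

lemma formula_A_eq_B:
  assumes "q \<noteq> 0" and "j i \<in> {1..n}" and "j (i + 1) \<in> {1..n}"
  shows "formula_A q i j k = formula_B n q i j k"
proof -
  \<comment> \<open>All scalars become opaque field elements, so the identities are plain field
    arithmetic; \<open>R\<close> stands for the inverse of \<open>q\<close> and is linked to
    \<open>Q\<close> only by \<open>Q * R = 1\<close>.\<close>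
  define x y z zs Q R where d: "x = var i" "y = var (i + 1)" "z = mon k"
    "zs = mon (swap_exponent i k)" "Q = cst q" "R = cst (inverse q)"
  have ne: "x - y \<noteq> 0"
    using var_neq[of i "i + 1"] by (simp add: d)
  have c: "cst (1 - q\<^sup>2) = 1 - Q * Q" "cst (q\<^sup>2 - 1) = Q * Q - 1" "cst (q - inverse q) = Q - R"
    by (simp_all add: d const_simps rat_simps power2_eq_square)
  have QR: "Q * R = 1"
    using assms(1) by (simp add: d const_simps(1) rat_simps(2) flip: const_simps(3) rat_simps(4))
  have sj: "swap_index i j = j" if "j i = j (i + 1)"
    using that by (auto simp: swap_index_eq)
  have A: "formula_A q i j k =
     (if j i < j (i + 1) then
       pure_tensor j ((1 - Q * Q) * ((y * zs - x * z) / (x - y))) - pure_tensor (swap_index i j) (Q * zs)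
     else if j i = j (i + 1) then
       pure_tensor j ((1 - Q * Q) * ((x * (zs - z)) / (x - y))) - pure_tensor (swap_index i j) zs
     else
       pure_tensor j ((1 - Q * Q) * ((x * (zs - z)) / (x - y))) - pure_tensor (swap_index i j) (Q * zs))"
    unfolding formula_A_def Let_def c smult_single d ..
  have B: "formula_B n q i j k = pure_tensor j ((Q * Q - 1) * (x / (x - y)) * z)
       - smult (Q / (x - y)) (tau_R n q i x y (pure_tensor j zs))"
    unfolding formula_B_def Let_def c smult_single d ..
  \<comment> \<open>Both \<open>k1\<close> and \<open>k2\<close> absorb the prefactor
    \<open>q\<close> of formula (B) and thereby eliminate \<open>R\<close>.\<close>
  have k1: "Q * ((Q - R) * w) = (Q * Q - 1) * w" for w
  proof -
    have "Q * ((Q - R) * w) = (Q * Q - Q * R) * w"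
      by (simp add: algebra_simps)
    then show ?thesis by (simp add: QR)
  qed
  have k2: "Q * ((Q * x - R * y) * w) = (Q * Q * x - y) * w" for w
  proof -
    have "Q * ((Q * x - R * y) * w) = (Q * Q * x - Q * R * y) * w"
      by (simp add: algebra_simps)
    then show ?thesis by (simp add: QR)
  qed
  have k3: "Q / (x - y) * ((x - y) * w) = Q * w" for w
    using ne by simp
  consider "j i < j (i + 1)" | "j i = j (i + 1)" | "j i > j (i + 1)" by linarith
  then show ?thesis
  proof cases
    case 1
    have "(1 - Q * Q) * ((y * zs - x * z) / (x - y))
        = (Q * Q - 1) * (x / (x - y)) * z - Q / (x - y) * ((Q - R) * (y * zs))"
      using ne by (simp add: divide_simps k1) (simp add: algebra_simps)
    moreover have t: "tau_R n q i x y (pure_tensor j zs) =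
        pure_tensor (swap_index i j) ((x - y) * zs) + pure_tensor j ((Q - R) * (y * zs))"
      using tau_R_single_neq[of j i n q x y zs] 1 assms by (simp add: c)
    ultimately show ?thesis
      unfolding A B t smult_add smult_single k3 if_P[OF 1]
      by (simp only: single_diff diff_diff_eq add.commute)
  next
    case 2
    then have n: "\<not> j i < j (i + 1)" by simp
    \<comment> \<open>Here the swap fixes \<open>j\<close>, so both tensors of formula (A) sit at
      the same index and their coefficients must be merged before comparing.\<close>
    have "(1 - Q * Q) * ((x * (zs - z)) / (x - y)) - zs
        = (Q * Q - 1) * (x / (x - y)) * z - Q / (x - y) * ((Q * x - R * y) * zs)"
      using ne by (simp add: divide_simps k2) (simp add: algebra_simps)
    moreover have t: "tau_R n q i x y (pure_tensor j zs) = pure_tensor j ((Q * x - R * y) * zs)"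
      using tau_R_single_eq[of j i n q x y zs] 2 assms by (simp add: d)
    ultimately show ?thesis
      unfolding A B t smult_single sj[OF 2] if_not_P[OF n] if_P[OF 2]
      by (simp only: flip: single_diff)
  next
    case 3
    then have n: "\<not> j i < j (i + 1)" "j i \<noteq> j (i + 1)" by simp_all
    have "(1 - Q * Q) * ((x * (zs - z)) / (x - y))
        = (Q * Q - 1) * (x / (x - y)) * z - Q / (x - y) * ((Q - R) * (x * zs))"
      using ne by (simp add: divide_simps k1) (simp add: algebra_simps)
    moreover have t: "tau_R n q i x y (pure_tensor j zs) =
        pure_tensor (swap_index i j) ((x - y) * zs) + pure_tensor j ((Q - R) * (x * zs))"
      using tau_R_single_neq[of j i n q x y zs] 3 assms by (simp add: c)
    ultimately show ?thesis
      unfolding A B t smult_add smult_single k3 if_not_P[OF n(1)] if_not_P[OF n(2)]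
      by (simp only: single_diff diff_diff_eq add.commute)
  qed
qed

section \<open>The presentation of the affine Hecke algebra\<close>

lemma free_alg_simps [simp]:
  "mult (free_alg N) = (*)" "one (free_alg N) = 1" "zero (free_alg N) = 0"
  "add (free_alg N) = (+)"
  by (simp_all add: free_alg_def)

lemma free_alg_carrier:
  "p \<in> carrier (free_alg N) \<longleftrightarrow> (\<forall>w\<in>Poly_Mapping.keys p. set (letters w) \<subseteq> hecke_gens N)"
  by (simp add: free_alg_def)

lemma free_alg_single:
  "set (letters w) \<subseteq> hecke_gens N \<Longrightarrow> Poly_Mapping.single w c \<in> carrier (free_alg N)"
  by (simp add: free_alg_carrier)

lemma free_alg_closed [simp]:
  shows free_alg_zero: "0 \<in> carrier (free_alg N)"
    and free_alg_one: "1 \<in> carrier (free_alg N)"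
    and free_alg_scalar: "scalar c \<in> carrier (free_alg N)"
    and free_alg_gen: "g \<in> hecke_gens N \<Longrightarrow> gen g \<in> carrier (free_alg N)"
  using free_alg_single[of 0 N]
  by (simp_all add: free_alg_carrier scalar_def gen_def zero_word_def flip: single_one)

lemma free_alg_closed_ops [simp]:
  assumes "p \<in> carrier (free_alg N)" and "p' \<in> carrier (free_alg N)"
  shows free_alg_add: "p + p' \<in> carrier (free_alg N)"
    and free_alg_diff: "p - p' \<in> carrier (free_alg N)"
    and free_alg_mult: "p * p' \<in> carrier (free_alg N)"
proof -
  show "p + p' \<in> carrier (free_alg N)"
    using assms Poly_Mapping.keys_add[of p p'] unfolding free_alg_carrier by blast
  show "p - p' \<in> carrier (free_alg N)"
    using assms keys_diff[of p p'] unfolding free_alg_carrier by blast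
  show "p * p' \<in> carrier (free_alg N)"
    unfolding free_alg_carrier
  proof
    fix w assume "w \<in> Poly_Mapping.keys (p * p')"
    then obtain u u' where "w = u + u'" "u \<in> Poly_Mapping.keys p" "u' \<in> Poly_Mapping.keys p'"
      using keys_mult[of p p'] by blast
    then show "set (letters w) \<subseteq> hecke_gens N"
      using assms by (simp add: free_alg_carrier plus_word_def)
  qed
qed

text \<open>An element is the finite sum of its terms. The single-term case covers only terms of
  \<open>f\<close> itself, so conditions on the support of \<open>f\<close> are available
  there.\<close>

lemma poly_mapping_add_induct:
  fixes f :: "'a \<Rightarrow>\<^sub>0 'b::comm_monoid_add"
  assumes "P 0" and "\<And>k. k \<in> Poly_Mapping.keys f \<Longrightarrow> P (Poly_Mapping.single k (Poly_Mapping.lookup f k))"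
    and "\<And>g h. P g \<Longrightarrow> P h \<Longrightarrow> P (g + h)"
  shows "P f"
proof -
  \<comment> \<open>Partial sums over subsets of the support allow induction on a finite set while
    the coefficients of \<open>f\<close> stay fixed.\<close>
  have "P (\<Sum>k\<in>K. Poly_Mapping.single k (Poly_Mapping.lookup f k))"
    if "finite K" "K \<subseteq> Poly_Mapping.keys f" for K
    using that by (induction K rule: finite_induct) (simp_all add: assms)
  moreover have "(\<Sum>k\<in>Poly_Mapping.keys f. Poly_Mapping.single k (Poly_Mapping.lookup f k)) = f"
    by (rule poly_mapping_eqI) (auto simp: lookup_sum lookup_single when_def in_keys_iff)
  ultimately show ?thesis
    by (metis finite_keys order_refl)
qed

text \<open>A scalar sits on the empty word, the unit of the word monoid, and complex coefficients
  commute.\<close>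

lemma scalar_commute: "scalar c * p = p * scalar c"
  by (rule poly_mapping_add_induct[where f = p])
    (simp_all add: scalar_def mult_single algebra_simps)

lemma ring_free_alg: "ring (free_alg N)"
proof (intro ringI abelian_groupI monoidI)
  fix p assume "p \<in> carrier (free_alg N)"
  then show "\<exists>p'\<in>carrier (free_alg N). p' \<oplus>\<^bsub>free_alg N\<^esub> p = \<zero>\<^bsub>free_alg N\<^esub>"
    \<comment> \<open>The negative is written as \<open>0 - p\<close> so that closure under
      differences applies.\<close>
    by (intro bexI[of _ "0 - p"]) (simp, blast intro: free_alg_diff free_alg_zero)
qed (simp_all add: algebra_simps)

section \<open>The relations, their ideal and the quotient\<close>

lemma hecke_gens_mem [simp]:
  "T i \<in> hecke_gens N \<longleftrightarrow> i \<in> {1..<N}"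
  "Y i \<in> hecke_gens N \<longleftrightarrow> i \<in> {1..N}"
  "Yinv i \<in> hecke_gens N \<longleftrightarrow> i \<in> {1..N}"
  by (auto simp: hecke_gens_def)

lemma hecke_relations_carrier: "hecke_relations N t \<subseteq> carrier (free_alg N)"
  unfolding hecke_relations_def by auto

lemma ideal_hecke_ideal: "ideal (hecke_ideal N t) (free_alg N)"
  unfolding hecke_ideal_def
  by (rule ring.genideal_ideal[OF ring_free_alg hecke_relations_carrier])

lemma ring_hom_hecke_class: "hecke_class N t \<in> ring_hom (free_alg N) (affine_hecke N t)"
  using ideal.rcos_ring_hom[OF ideal_hecke_ideal] by (simp add: hecke_class_def[abs_def] affine_hecke_def)

lemma carrier_affine_hecke: "carrier (affine_hecke N t) = hecke_class N t ` carrier (free_alg N)"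
  by (auto simp: affine_hecke_def FactRing_def A_RCOSETS_def' hecke_class_def)

lemma hecke_class_carrier: "p \<in> carrier (free_alg N) \<Longrightarrow> hecke_class N t p \<in> carrier (affine_hecke N t)"
  by (simp add: carrier_affine_hecke)

text \<open>A defining relation lies in the generated ideal, so its coset is zero; splitting
  \<open>p\<close> as \<open>(p - p') + p'\<close> and using additivity of the class map gives the
  claim.\<close>

lemma hecke_class_eqI:
  assumes "p - p' \<in> hecke_relations N t" and "p' \<in> carrier (free_alg N)"
  shows "hecke_class N t p = hecke_class N t p'"
proof -
  interpret R: ring "free_alg N" by (rule ring_free_alg)
  interpret I: ideal "hecke_ideal N t" "free_alg N" by (rule ideal_hecke_ideal)
  interpret Q: ring "affine_hecke N t"
    unfolding affine_hecke_def by (rule I.quotient_is_ring)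
  have mem: "p - p' \<in> hecke_ideal N t"
    using R.genideal_self[OF hecke_relations_carrier] assms(1) by (auto simp: hecke_ideal_def)
  then have "hecke_class N t (p - p') = \<zero>\<^bsub>affine_hecke N t\<^esub>"
    using R.a_rcos_zero[OF ideal_hecke_ideal] by (simp add: hecke_class_def affine_hecke_def FactRing_def)
  moreover have "hecke_class N t (p - p' + p') =
      hecke_class N t (p - p') \<oplus>\<^bsub>affine_hecke N t\<^esub> hecke_class N t p'"
    using ring_hom_add[OF ring_hom_hecke_class I.Icarr[OF mem] assms(2)] by simp
  moreover have "hecke_class N t p' \<in> carrier (affine_hecke N t)"
    using assms(2) by (rule hecke_class_carrier)
  ultimately show ?thesis by simp
qed

text \<open>In a right action the left factor acts first, so this order of the product is the one
  that determines the action of \<open>Yinv i\<close> from that of \<open>Y i\<close>.\<close>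

lemma hecke_class_Yinv_Y:
  assumes "i \<in> {1..N}"
  shows "hecke_class N t (gen (Yinv i) * gen (Y i)) = hecke_class N t 1"
proof (rule hecke_class_eqI)
  show "gen (Yinv i) * gen (Y i) - 1 \<in> hecke_relations N t"
    using assms unfolding hecke_relations_def by blast
qed (rule free_alg_one)

section \<open>Spanning by the basis vectors\<close>

lemma Vz_add: "v \<in> Vz n N \<Longrightarrow> w \<in> Vz n N \<Longrightarrow> v + w \<in> Vz n N"
  using Poly_Mapping.keys_add[of v w]
    Poly_Mapping.keys_add[of "Poly_Mapping.lookup v j" "Poly_Mapping.lookup w j" for j]
  unfolding Vz_def by (simp add: lookup_add) blast

lemma Vz_zero: "0 \<in> Vz n N"
  by (simp add: Vz_def)

lemma basis_vec_Vz:
  "j \<in> multi_indices n N \<Longrightarrow> k \<in> exponents N \<Longrightarrow> smult (const c) (basis_vec j k) \<in> Vz n N"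
  by (simp add: Vz_def basis_vec_def monomial_def const_def mult_single lookup_single when_def)

text \<open>Two nested additive inductions: over the multi-indices of \<open>v\<close>, then over
  the monomials of each Laurent coefficient. The remaining pieces are complex multiples of basis
  vectors.\<close>

lemma Vz_induct [consumes 1, case_names zero basis add]:
  assumes "v \<in> Vz n N" and "P 0"
    and basis: "\<And>j k c. j \<in> multi_indices n N \<Longrightarrow> k \<in> exponents N \<Longrightarrow>
           P (smult (const c) (basis_vec j k))"
    and "\<And>v w. v \<in> Vz n N \<Longrightarrow> w \<in> Vz n N \<Longrightarrow> P v \<Longrightarrow> P w \<Longrightarrow> P (v + w)"
  shows "P v"
proof -
  \<comment> \<open>Membership is carried along because the addition case is assumed only for
    summands in \<open>Vz n N\<close>.\<close>
  let ?P = "\<lambda>v. v \<in> Vz n N \<and> P v"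
  have add: "?P (v + w)" if "?P v" "?P w" for v w
    using that assms(4) Vz_add by blast
  have "?P v"
  proof (rule poly_mapping_add_induct[where P = ?P])
    fix j assume j: "j \<in> Poly_Mapping.keys v"
    let ?f = "Poly_Mapping.lookup v j"
    show "?P (Poly_Mapping.single j ?f)"
    proof (rule poly_mapping_add_induct[where P = "\<lambda>g. ?P (Poly_Mapping.single j g)" and f = ?f])
      fix k assume "k \<in> Poly_Mapping.keys ?f"
      then have "j \<in> multi_indices n N" "k \<in> exponents N"
        using j assms(1) by (auto simp: Vz_def)
      then have "?P (smult (const c) (basis_vec j k))" for c
        using basis basis_vec_Vz by blast
      then show "?P (Poly_Mapping.single j (Poly_Mapping.single k (Poly_Mapping.lookup ?f k)))"
        by (simp add: basis_vec_def monomial_def const_def mult_single)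
    qed (use add assms(2) Vz_zero in \<open>simp_all add: single_add\<close>)
  qed (use add assms(2) Vz_zero in blast)+
  then show ?thesis ..
qed

text \<open>The formulas prescribe the action only after extension of scalars; injectivity brings
  equalities back to Laurent vectors.\<close>

lemma to_rat_inject: "to_rat F = to_rat G \<longleftrightarrow> F = G"
proof
  assume eq: "to_rat F = to_rat G"
  have "Poly_Mapping.lookup (to_rat F) j = rat (Poly_Mapping.lookup F j)" for F j
    by (simp add: to_rat_def Poly_Mapping.map.rep_eq when_def rat_simps(1))
  with eq show "F = G"
    by (metis poly_mapping_eqI rat_eq_iff)
qed simp

section \<open>Uniqueness of the action\<close>

text \<open>The module axioms concern cosets; since the class map is a ring homomorphism, they can
  be restated for representatives in the free algebra.\<close>

lemma hecke_action_simps: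
  assumes "hecke_action n N t act" and "v \<in> Vz n N" and "p \<in> carrier (free_alg N)"
  shows hecke_action_closed: "act v (hecke_class N t p) \<in> Vz n N"
    and hecke_action_zero_left: "act 0 (hecke_class N t p) = 0"
    and hecke_action_add_left: "w \<in> Vz n N \<Longrightarrow>
          act (v + w) (hecke_class N t p) = act v (hecke_class N t p) + act w (hecke_class N t p)"
    and hecke_action_scalar: "act v (hecke_class N t (scalar c)) = smult (const c) v"
    and hecke_action_add: "p' \<in> carrier (free_alg N) \<Longrightarrow>
          act v (hecke_class N t (p + p')) = act v (hecke_class N t p) + act v (hecke_class N t p')"
    and hecke_action_mult: "p' \<in> carrier (free_alg N) \<Longrightarrow>
          act v (hecke_class N t (p * p')) = act (act v (hecke_class N t p)) (hecke_class N t p')"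
proof -
  note act = assms(1)[unfolded hecke_action_def right_action_def]
  note cl = hecke_class_carrier[OF assms(3), of t]
  show "act v (hecke_class N t p) \<in> Vz n N"
    using act assms(2) cl by blast
  have add_left: "act (v + w) (hecke_class N t p) = act v (hecke_class N t p) + act w (hecke_class N t p)"
    if "v \<in> Vz n N" "w \<in> Vz n N" for v w
    using act that cl by blast
  \<comment> \<open>Additivity at \<open>0 + 0\<close>, followed by cancellation.\<close>
  show "act 0 (hecke_class N t p) = 0"
    using add_left[OF Vz_zero Vz_zero] by simp
  show "act (v + w) (hecke_class N t p) = act v (hecke_class N t p) + act w (hecke_class N t p)"
    if "w \<in> Vz n N"
    using add_left assms(2) that .
  show "act v (hecke_class N t (scalar c)) = smult (const c) v"
    using act assms(2) by blast
  show "act v (hecke_class N t (p + p')) = act v (hecke_class N t p) + act v (hecke_class N t p')"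
    if "p' \<in> carrier (free_alg N)"
    using act assms(2) cl hecke_class_carrier[OF that, of t]
      ring_hom_add[OF ring_hom_hecke_class assms(3) that, of t] by simp
  show "act v (hecke_class N t (p * p')) = act (act v (hecke_class N t p)) (hecke_class N t p')"
    if "p' \<in> carrier (free_alg N)"
    using act assms(2) cl hecke_class_carrier[OF that, of t]
      ring_hom_mult[OF ring_hom_hecke_class assms(3) that, of t] by simp
qed

text \<open>Linearity in the vector is derived: scaling is the action of a scalar class, and scalars
  commute with \<open>p\<close>, so scaling before or after acting is the same.\<close>

lemma hecke_action_smult_left:
  assumes act: "hecke_action n N t act" and "v \<in> Vz n N" and "p \<in> carrier (free_alg N)"
  shows "act (smult (const c) v) (hecke_class N t p) = smult (const c) (act v (hecke_class N t p))"
proof -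
  have "act (smult (const c) v) (hecke_class N t p) = act v (hecke_class N t (scalar c * p))"
    using hecke_action_mult[OF act assms(2) free_alg_scalar assms(3)]
      hecke_action_scalar[OF act assms(2,3)] by simp
  also have "\<dots> = smult (const c) (act v (hecke_class N t p))"
    unfolding scalar_commute
    using hecke_action_mult[OF act assms(2,3) free_alg_scalar]
      hecke_action_scalar[OF act hecke_action_closed[OF act assms(2,3)] assms(3)] by simp
  finally show ?thesis .
qed

lemma hecke_action_eq_of_basis:
  assumes A: "hecke_action n N t actA" and B: "hecke_action n N t actB"
    and p: "p \<in> carrier (free_alg N)"
    and eq: "\<And>j k. j \<in> multi_indices n N \<Longrightarrow> k \<in> exponents N \<Longrightarrow>
          actA (basis_vec j k) (hecke_class N t p) = actB (basis_vec j k) (hecke_class N t p)"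
    and "v \<in> Vz n N"
  shows "actA v (hecke_class N t p) = actB v (hecke_class N t p)"
  using \<open>v \<in> Vz n N\<close>
proof (induction rule: Vz_induct)
  case zero
  show ?case
    using hecke_action_zero_left[OF A Vz_zero p] hecke_action_zero_left[OF B Vz_zero p] by simp
next
  case (basis j k c)
  then have "basis_vec j k \<in> Vz n N"
    using basis_vec_Vz[of j n N k 1] by (simp add: const_simps)
  then show ?case
    using basis eq hecke_action_smult_left[OF A _ p] hecke_action_smult_left[OF B _ p] by simp
next
  case (add v w)
  then show ?case
    using hecke_action_add_left[OF A _ p] hecke_action_add_left[OF B _ p] by simp
qed

text \<open>Agreement spreads from generators to words by multiplicativity, then to all
  representatives by additivity.\<close>

lemma hecke_action_eq_of_gens:
  assumes A: "hecke_action n N t actA" and B: "hecke_action n N t actB"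
    and eq: "\<And>g v. g \<in> hecke_gens N \<Longrightarrow> v \<in> Vz n N \<Longrightarrow>
          actA v (hecke_class N t (gen g)) = actB v (hecke_class N t (gen g))"
    and "v \<in> Vz n N" and "h \<in> carrier (affine_hecke N t)"
  shows "actA v h = actB v h"
proof -
  \<comment> \<open>All vectors are quantified over because the first letter of a word changes the
    vector on which the rest acts.\<close>
  let ?P = "\<lambda>p. p \<in> carrier (free_alg N) \<and>
    (\<forall>v\<in>Vz n N. actA v (hecke_class N t p) = actB v (hecke_class N t p))"
  have scalar: "?P (scalar c)" for c
    using hecke_action_scalar[OF A _ free_alg_zero] hecke_action_scalar[OF B _ free_alg_zero] by simp
  have word: "?P (Poly_Mapping.single (Word gs) c)" if "set gs \<subseteq> hecke_gens N" for gs c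
    using that
  proof (induction gs)
    case Nil
    show ?case using scalar[of c] by (simp add: scalar_def zero_word_def)
  next
    case (Cons g gs)
    let ?w = "Poly_Mapping.single (Word gs) c"
    \<comment> \<open>The coefficient stays with the tail and ends up on the empty word, where it
      acts as a scalar.\<close>
    have split: "Poly_Mapping.single (Word (g # gs)) c = gen g * ?w"
      by (simp add: gen_def mult_single plus_word_def)
    have g: "g \<in> hecke_gens N" and w: "?P ?w"
      using Cons by simp_all
    have "actA v (hecke_class N t (gen g * ?w)) = actB v (hecke_class N t (gen g * ?w))"
      if v: "v \<in> Vz n N" for v
      using hecke_action_mult[OF A v free_alg_gen[OF g]] hecke_action_mult[OF B v free_alg_gen[OF g]]
        hecke_action_closed[OF B v free_alg_gen[OF g]] eq[OF g v] w by simp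
    then show ?case
      using g w unfolding split by simp
  qed
  obtain p where p: "p \<in> carrier (free_alg N)" "h = hecke_class N t p"
    using assms(5) by (auto simp: carrier_affine_hecke)
  have "?P p"
  proof (rule poly_mapping_add_induct[where P = ?P])
    show "?P 0"
      using scalar[of 0] by (simp add: scalar_def)
    show "?P (Poly_Mapping.single w (Poly_Mapping.lookup p w))" if "w \<in> Poly_Mapping.keys p" for w
      using that p(1) word[of "letters w"] by (simp add: free_alg_carrier)
    show "?P (p' + p'')" if "?P p'" "?P p''" for p' p''
      using that hecke_action_add[OF A] hecke_action_add[OF B] by simp
  qed
  then show ?thesis
    using p(2) assms(4) by blast
qed

text \<open>With \<open>w\<close> the image of \<open>v\<close> under \<open>Yinv i\<close>,
  applying \<open>Y i\<close> returns \<open>v\<close>, so \<open>w\<close> times the inverse of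
  \<open>z_i\<close> is \<open>v\<close>; multiplying by \<open>z_i\<close> recovers
  \<open>w\<close>.\<close>

lemma acts_by_Yinv_eq:
  assumes act: "hecke_action n N t act" and "acts_by n N t rhs act"
    and i: "i \<in> {1..N}" and v: "v \<in> Vz n N"
  shows "act v (hecke_class N t (gen (Yinv i))) = smult (monomial (Poly_Mapping.single i 1)) v"
proof -
  have gens: "gen (Yinv i) \<in> carrier (free_alg N)" "gen (Y i) \<in> carrier (free_alg N)"
    using i by simp_all
  let ?w = "act v (hecke_class N t (gen (Yinv i)))"
  have w: "?w \<in> Vz n N"
    by (rule hecke_action_closed[OF act v gens(1)])
  have "v = act v (hecke_class N t 1)"
    using hecke_action_scalar[OF act v free_alg_one, of 1]
    by (simp add: scalar_def const_simps)
  also have "\<dots> = act v (hecke_class N t (gen (Yinv i) * gen (Y i)))"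
    by (simp only: hecke_class_Yinv_Y[OF i])
  also have "\<dots> = smult (monomial (Poly_Mapping.single i (-1))) ?w"
    using hecke_action_mult[OF act v gens] assms(2) i w by (simp add: acts_by_def)
  finally have "smult (monomial (Poly_Mapping.single i 1)) v =
      smult (monomial (Poly_Mapping.single i 1) * monomial (Poly_Mapping.single i (-1))) ?w"
    by (metis smult_smult)
  also have "monomial (Poly_Mapping.single i 1) * monomial (Poly_Mapping.single i (-1)) = 1"
    by (simp add: monomial_def mult_single flip: single_add)
  finally show ?thesis by simp
qed

text \<open>Each kind of generator has its own reason: \<open>T i\<close> is fixed on basis vectors
  and extended linearly, \<open>Y i\<close> is prescribed on every vector, and \<open>Yinv i\<close>
  is forced by \<open>Y i\<close>.\<close>

lemma acts_by_unique:
  assumes A: "hecke_action n N t actA" and rA: "acts_by n N t rhs actA"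
    and B: "hecke_action n N t actB" and rB: "acts_by n N t rhs' actB"
    and rhs: "\<And>i j k. i \<in> {1..<N} \<Longrightarrow> j \<in> multi_indices n N \<Longrightarrow> k \<in> exponents N \<Longrightarrow>
          rhs i j k = rhs' i j k"
    and "v \<in> Vz n N" and "h \<in> carrier (affine_hecke N t)"
  shows "actA v h = actB v h"
proof (rule hecke_action_eq_of_gens[OF A B _ assms(6,7)])
  fix g v assume "g \<in> hecke_gens N" and v: "v \<in> Vz n N"
  then consider i where "g = T i" "i \<in> {1..<N}" | i where "g = Y i" "i \<in> {1..N}"
    | i where "g = Yinv i" "i \<in> {1..N}"
    by (auto simp: hecke_gens_def)
  then show "actA v (hecke_class N t (gen g)) = actB v (hecke_class N t (gen g))"
  proof cases
    case (1 i)
    have "actA (basis_vec j k) (hecke_class N t (gen (T i))) =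
        actB (basis_vec j k) (hecke_class N t (gen (T i)))"
      if "j \<in> multi_indices n N" "k \<in> exponents N" for j k
      using rA rB rhs 1(2) that unfolding acts_by_def by (metis to_rat_inject)
    then show ?thesis
      using hecke_action_eq_of_basis[OF A B _ _ v] 1 by simp
  next
    case (2 i)
    then show ?thesis
      using rA rB v by (simp add: acts_by_def)
  next
    case (3 i)
    then show ?thesis
      using acts_by_Yinv_eq[OF A rA _ v] acts_by_Yinv_eq[OF B rB _ v] by simp
  qed
qed

theorem theorem2p5:
  fixes n N :: nat and q :: complex
  assumes "n \<ge> 1" and "N \<ge> 1"
    and "q \<noteq> 0" and "\<forall>m::nat. m > 0 \<longrightarrow> q ^ m \<noteq> 1"
  shows "(\<forall>i\<in>{1..<N}. \<forall>j\<in>multi_indices n N. \<forall>k\<in>exponents N.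
            formula_A q i j k = formula_B n q i j k)
       \<and> (\<forall>actA actB.
            hecke_action n N (q\<^sup>2) actA \<and> acts_by n N (q\<^sup>2) (formula_A q) actA \<and>
            hecke_action n N (q\<^sup>2) actB \<and> acts_by n N (q\<^sup>2) (formula_B n q) actB \<longrightarrow>
            (\<forall>v\<in>Vz n N. \<forall>h\<in>carrier (affine_hecke N (q\<^sup>2)). actA v h = actB v h))"
proof -
  have eq: "formula_A q i j k = formula_B n q i j k"
    if "i \<in> {1..<N}" "j \<in> multi_indices n N" for i j k
  proof (rule formula_A_eq_B[OF assms(3)])
    \<comment> \<open>Since \<open>i\<close> is strictly below \<open>N\<close>, position
      \<open>i + 1\<close> is still in the domain of \<open>j\<close>.\<close>
    show "j i \<in> {1..n}" "j (i + 1) \<in> {1..n}"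
      using that by (auto simp: multi_indices_def intro: PiE_mem)
  qed
  moreover have "actA v h = actB v h"
    if "hecke_action n N (q\<^sup>2) actA" "acts_by n N (q\<^sup>2) (formula_A q) actA"
      "hecke_action n N (q\<^sup>2) actB" "acts_by n N (q\<^sup>2) (formula_B n q) actB"
      "v \<in> Vz n N" "h \<in> carrier (affine_hecke N (q\<^sup>2))" for actA actB v h
    using acts_by_unique[OF that(1-4) eq that(5,6)] by blast
  ultimately show ?thesis by blast
qed
end
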